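(* Let $(\epsilon_1,\epsilon_2)\in\{(-1,-1),(-1,1),(1,-1)\}$ and $\epsilon=-\epsilon_1\epsilon_2$. Let $L$ be the simply connected Lie group with Lie algebra $\mathfrak{l}$, $\bar g$ the left-invariant metric on $L$ defined by the scalar product $\langle\cdot,\cdot\rangle$ on $\mathfrak{l}$ as given in the context, and $\nabla$ its Levi-Civita connection. Then the curvature endomorphisms $R(X,Y)=[\nabla_X,\nabla_Y]-\nabla_{[X,Y]}$ of $(L,\bar g)$ are given by: $$\begin{aligned} &R(U^2,V_2)=-\nabla_{V_2},\quad R(U^2,B)=R(U^2,A)=0,\\ &R(U^2,V_0)=-\tfrac12\nabla_{V_0},\quad R(U^2,V_1)=-\tfrac12\nabla_{V_1},\quad R(U^2,U^0)=-\tfrac12\nabla_{U^0},\quad R(U^2,U^1)=-\tfrac12\nabla_{U^1},\\ &R(V_2,B)=R(V_2,A)=0,\quad R(V_2,V_0)=\tfrac12\epsilon\nabla_{U^0},\quad R(V_2,V_1)=\tfrac12\epsilon_2\nabla_{U^1},\\ &R(V_2,U^0)=-\tfrac12\epsilon_2\nabla_{V_0},\quad R(V_2,U^1)=-\tfrac12\epsilon\nabla_{V_1},\\ &R(B,A)=-\tfrac1{\sqrt3}\nabla_A,\quad R(B,V_0)=\tfrac{\sqrt3}2\nabla_{V_0},\quad R(B,V_1)=\tfrac1{2\sqrt3}\nabla_{V_1},\\ &R(B,U^0)=-\tfrac{\sqrt3}2\nabla_{U^0},\quad R(B,U^1)=-\tfrac1{2\sqrt3}\nabla_{U^1},\\ &R(A,V_0)=-\tfrac12\nabla_{V_1},\quad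 R(A,V_1)=\tfrac12\epsilon_1\nabla_{V_0}+\tfrac1{\sqrt3}\nabla_{U^1},\\ &R(A,U^0)=-\tfrac12\epsilon_1\nabla_{U^1},\quad R(A,U^1)=\tfrac12\nabla_{U^0}-\tfrac1{\sqrt3}\epsilon_1\nabla_{V_1},\\ &R(V_0,V_1)=-\tfrac12\epsilon\nabla_A,\quad R(V_0,U^0)=\tfrac12\nabla_{V_2},\quad R(V_0,U^1)=0,\\ &R(V_1,U^0)=0,\quad R(V_1,U^1)=\tfrac12\nabla_{V_2}+\tfrac1{\sqrt3}\epsilon_2\nabla_A,\quad R(U^0,U^1)=-\tfrac12\epsilon\nabla_A. \end{aligned}$$
   Context: The Lie algebra $\mathfrak{l}$ has basis $(T_1,\dots,T_8)=(V_2,U^2,A,B,V_0,V_1,U^0,U^1)$ with brackets (all not determined by these and skew-symmetry vanish): $[B,A]=\frac1{\sqrt3}A$, $[U^2,V_2]=V_2$, $[V_0,U^0]=-V_2$, $[V_1,U^1]=-V_2$, $[U^2,V_I]=\frac12V_I$ and $[U^2,U^I]=\frac12U^I$ for $I=0,1$, $[B,V_0]=-\frac{\sqrt3}2V_0$, $[B,V_1]=-\frac1{2\sqrt3}V_1$, $[B,U^0]=\frac{\sqrt3}2U^0$, $[B,U^1]=\frac1{2\sqrt3}U^1$, $[A,V_0]=V_1$, $[A,U^1]=-U^0$, $[A,V_1]=-\frac2{\sqrt3}U^1$. The scalar product $\langle\cdot,\cdot\rangle$ has Gram matrix $\mathrm{diag}(-\epsilon_1,1,-\epsilon_1,1,-\epsilon,-\epsilon_2,-\epsilon_2,-\epsilon)$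 in this basis. Elements of $\mathfrak{l}$ are identified with left-invariant vector fields on $L$; for $X\in\mathfrak{l}$, $\nabla_X$ is regarded as the endomorphism $Y\mapsto\nabla_XY$ of $\mathfrak{l}$, and $R(X,Y)$ as an endomorphism of $\mathfrak{l}$. *)

theory Defs
  imports "HOL-Analysis.Analysis" "HOL-Library.Function_Algebras" "HOL-Algebra.Group"
begin

section \<open>Functions as a real vector space\<close>

instantiation "fun" :: (type, real_vector) real_vector
begin

definition scaleR_fun :: "real \<Rightarrow> ('a \<Rightarrow> 'b) \<Rightarrow> 'a \<Rightarrow> 'b" where
  "scaleR_fun c f = (\<lambda>x. c *\<^sub>R f x)"

instance
  by standard (simp_all add: scaleR_fun_def fun_eq_iff scaleR_add_right scaleR_add_left)

end

section \<open>Smooth manifolds\<close>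

text \<open>The predicates \<open>Ck_on\<close> and \<open>smooth_on\<close> are meant for open sets \<open>S\<close>.\<close>

primrec Ck_on :: "nat \<Rightarrow> 'a::euclidean_space set \<Rightarrow> ('a \<Rightarrow> 'b::real_normed_vector) \<Rightarrow> bool" where
  "Ck_on 0 S f \<longleftrightarrow> continuous_on S f"
| "Ck_on (Suc k) S f \<longleftrightarrow> (\<forall>x\<in>S. f differentiable (at x)) \<and>
     (\<forall>h. Ck_on k S (\<lambda>x. frechet_derivative f (at x) h))"

definition smooth_on :: "'a::euclidean_space set \<Rightarrow> ('a \<Rightarrow> 'b::real_normed_vector) \<Rightarrow> bool" where
  "smooth_on S f \<longleftrightarrow> (\<forall>k. Ck_on k S f)"

text \<open>The underlying space of a manifold is a whole type; a chart is a pair of an open set and a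
  map that is a homeomorphism from that set onto an open subset of a Euclidean space. Atlases need
  not be maximal.\<close>

type_synonym ('a, 'e) chart = "'a set \<times> ('a \<Rightarrow> 'e)"

definition smooth_atlas :: "('a::topological_space, 'e::euclidean_space) chart set \<Rightarrow> bool" where
  "smooth_atlas \<A> \<longleftrightarrow>
     (\<Union>(U, \<phi>)\<in>\<A>. U) = UNIV \<and>
     (\<forall>(U, \<phi>)\<in>\<A>. open U \<and> open (\<phi> ` U) \<and> homeomorphism U (\<phi> ` U) \<phi> (inv_into U \<phi>)) \<and>
     (\<forall>(U, \<phi>)\<in>\<A>. \<forall>(V, \<psi>)\<in>\<A>. smooth_on (\<phi> ` (U \<inter> V)) (\<psi> \<circ> inv_into U \<phi>))"

definition smooth_functions :: "('a, 'e::euclidean_space) chart set \<Rightarrow> ('a \<Rightarrow> real) set" where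
  "smooth_functions \<A> = {f. \<forall>(U, \<phi>)\<in>\<A>. smooth_on (\<phi> ` U) (f \<circ> inv_into U \<phi>)}"

text \<open>Tangent vectors at \<open>p\<close> are derivations at \<open>p\<close> of the algebra of smooth functions. Since
  functionals are total in HOL, they are required to vanish off that algebra, so that equal
  derivations are equal as functionals.\<close>

type_synonym 'a tangent = "('a \<Rightarrow> real) \<Rightarrow> real"

definition tangent_space :: "('a, 'e::euclidean_space) chart set \<Rightarrow> 'a \<Rightarrow> 'a tangent set" where
  "tangent_space \<A> p = {v.
     (\<forall>f. f \<notin> smooth_functions \<A> \<longrightarrow> v f = 0) \<and>
     (\<forall>f\<in>smooth_functions \<A>. \<forall>c. v (c *\<^sub>R f) = c * v f) \<and>
     (\<forall>f\<in>smooth_functions \<A>. \<forall>h\<in>smooth_functions \<A>.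
        v (f + h) = v f + v h \<and> v (f * h) = f p * v h + h p * v f)}"

type_synonym 'a vfield = "'a \<Rightarrow> 'a tangent"

definition vector_fields :: "('a, 'e::euclidean_space) chart set \<Rightarrow> 'a vfield set" where
  "vector_fields \<A> = {X. (\<forall>p. X p \<in> tangent_space \<A> p) \<and>
     (\<forall>f\<in>smooth_functions \<A>. (\<lambda>p. X p f) \<in> smooth_functions \<A>)}"

definition vf_mult :: "('a \<Rightarrow> real) \<Rightarrow> 'a vfield \<Rightarrow> 'a vfield" where
  "vf_mult f X = (\<lambda>p. f p *\<^sub>R X p)"

definition vf_bracket :: "'a vfield \<Rightarrow> 'a vfield \<Rightarrow> 'a vfield" where
  "vf_bracket X Y = (\<lambda>p f. X p (\<lambda>q. Y q f) - Y p (\<lambda>q. X q f))"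

section \<open>Pseudo-Riemannian metrics and the Levi-Civita connection\<close>

type_synonym 'a metric = "'a \<Rightarrow> 'a tangent \<Rightarrow> 'a tangent \<Rightarrow> real"

definition pseudo_riemannian_metric ::
    "('a, 'e::euclidean_space) chart set \<Rightarrow> 'a metric \<Rightarrow> bool" where
  "pseudo_riemannian_metric \<A> g \<longleftrightarrow>
     (\<forall>p. \<forall>u\<in>tangent_space \<A> p. \<forall>v\<in>tangent_space \<A> p.
        g p u v = g p v u \<and>
        (\<forall>c. g p (c *\<^sub>R u) v = c * g p u v) \<and>
        (\<forall>w\<in>tangent_space \<A> p. g p (u + w) v = g p u v + g p w v)) \<and>
     (\<forall>p. \<forall>u\<in>tangent_space \<A> p. (\<forall>v\<in>tangent_space \<A> p. g p u v = 0) \<longrightarrow> u = 0) \<and>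
     (\<forall>X\<in>vector_fields \<A>. \<forall>Y\<in>vector_fields \<A>. (\<lambda>p. g p (X p) (Y p)) \<in> smooth_functions \<A>)"

definition affine_connection ::
    "('a, 'e::euclidean_space) chart set \<Rightarrow> ('a vfield \<Rightarrow> 'a vfield \<Rightarrow> 'a vfield) \<Rightarrow> bool" where
  "affine_connection \<A> D \<longleftrightarrow>
     (\<forall>X\<in>vector_fields \<A>. \<forall>Y\<in>vector_fields \<A>.
        D X Y \<in> vector_fields \<A> \<and>
        (\<forall>Z\<in>vector_fields \<A>. D (X + Z) Y = D X Y + D Z Y \<and> D X (Y + Z) = D X Y + D X Z) \<and>
        (\<forall>f\<in>smooth_functions \<A>.
           D (vf_mult f X) Y = vf_mult f (D X Y) \<and>
           D X (vf_mult f Y) = vf_mult (\<lambda>p. X p f) Y + vf_mult f (D X Y)))"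

definition levi_civita_connection ::
    "('a, 'e::euclidean_space) chart set \<Rightarrow> 'a metric \<Rightarrow>
     ('a vfield \<Rightarrow> 'a vfield \<Rightarrow> 'a vfield) \<Rightarrow> bool" where
  "levi_civita_connection \<A> g D \<longleftrightarrow>
     affine_connection \<A> D \<and>
     (\<forall>X\<in>vector_fields \<A>. \<forall>Y\<in>vector_fields \<A>. D X Y - D Y X = vf_bracket X Y) \<and>
     (\<forall>X\<in>vector_fields \<A>. \<forall>Y\<in>vector_fields \<A>. \<forall>Z\<in>vector_fields \<A>. \<forall>p.
        X p (\<lambda>q. g q (Y q) (Z q)) = g p (D X Y p) (Z p) + g p (Y p) (D X Z p))"

definition curvature ::
    "('a vfield \<Rightarrow> 'a vfield \<Rightarrow> 'a vfield) \<Rightarrow> 'a vfield \<Rightarrow> 'a vfield \<Rightarrow> 'a vfield \<Rightarrow> 'a vfield" where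
  "curvature D X Y Z = D X (D Y Z) - D Y (D X Z) - D (vf_bracket X Y) Z"

section \<open>Lie groups\<close>

text \<open>Smoothness of multiplication and inversion is expressed by continuity together with
  smoothness of all local representatives; continuity makes the domains of these open.\<close>

definition lie_group ::
    "('a::{t2_space, second_countable_topology}, 'm) monoid_scheme \<Rightarrow>
     ('a, 'e::euclidean_space) chart set \<Rightarrow> bool" where
  "lie_group G \<A> \<longleftrightarrow>
     group G \<and> carrier G = UNIV \<and> smooth_atlas \<A> \<and>
     continuous_on UNIV (\<lambda>(p, q). p \<otimes>\<^bsub>G\<^esub> q) \<and>
     (\<forall>(U, \<phi>)\<in>\<A>. \<forall>(V, \<psi>)\<in>\<A>. \<forall>(W, \<theta>)\<in>\<A>.
        smooth_on {(\<phi> p, \<psi> q) | p q. p \<in> U \<and> q \<in> V \<and> p \<otimes>\<^bsub>G\<^esub> q \<in> W}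
          (\<lambda>(x, y). \<theta> (inv_into U \<phi> x \<otimes>\<^bsub>G\<^esub> inv_into V \<psi> y))) \<and>
     continuous_on UNIV (\<lambda>p. inv\<^bsub>G\<^esub> p) \<and>
     (\<forall>(U, \<phi>)\<in>\<A>. \<forall>(W, \<theta>)\<in>\<A>.
        smooth_on {\<phi> p | p. p \<in> U \<and> inv\<^bsub>G\<^esub> p \<in> W} (\<lambda>x. \<theta> (inv\<^bsub>G\<^esub> (inv_into U \<phi> x))))"

text \<open>The differential of the left translation by \<open>a\<close>.\<close>

definition left_push :: "('a, 'm) monoid_scheme \<Rightarrow> 'a \<Rightarrow> 'a tangent \<Rightarrow> 'a tangent" where
  "left_push G a v = (\<lambda>f. v (\<lambda>q. f (a \<otimes>\<^bsub>G\<^esub> q)))"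

definition left_invariant_fields ::
    "('a, 'm) monoid_scheme \<Rightarrow> ('a, 'e::euclidean_space) chart set \<Rightarrow> 'a vfield set" where
  "left_invariant_fields G \<A> =
     {X \<in> vector_fields \<A>. \<forall>a p. X (a \<otimes>\<^bsub>G\<^esub> p) = left_push G a (X p)}"

definition left_invariant_metric ::
    "('a, 'm) monoid_scheme \<Rightarrow> ('a, 'e::euclidean_space) chart set \<Rightarrow> 'a metric \<Rightarrow> bool" where
  "left_invariant_metric G \<A> g \<longleftrightarrow>
     pseudo_riemannian_metric \<A> g \<and>
     (\<forall>a p. \<forall>u\<in>tangent_space \<A> p. \<forall>v\<in>tangent_space \<A> p.
        g (a \<otimes>\<^bsub>G\<^esub> p) (left_push G a u) (left_push G a v) = g p u v)"

text \<open>The Lie algebra of a Lie group is its tangent space at the identity, each element of which is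
  identified with its left-invariant extension. Accordingly, an identification of a Lie algebra with
  the Lie algebra of \<open>G\<close> is a linear, bracket preserving map into the left-invariant
  fields whose evaluation at the identity is a bijection onto the tangent space there.\<close>

definition lie_algebra_identification ::
    "('a, 'm) monoid_scheme \<Rightarrow> ('a, 'e::euclidean_space) chart set \<Rightarrow>
     ('v::real_vector \<Rightarrow> 'v \<Rightarrow> 'v) \<Rightarrow> ('v \<Rightarrow> 'a vfield) \<Rightarrow> bool" where
  "lie_algebra_identification G \<A> br \<Phi> \<longleftrightarrow>
     linear \<Phi> \<and>
     (\<forall>x. \<Phi> x \<in> left_invariant_fields G \<A>) \<and>
     bij_betw (\<lambda>x. \<Phi> x \<one>\<^bsub>G\<^esub>) UNIV (tangent_space \<A> \<one>\<^bsub>G\<^esub>) \<and>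
     (\<forall>x y. \<Phi> (br x y) = vf_bracket (\<Phi> x) (\<Phi> y))"

section \<open>The Lie algebra with its scalar product\<close>

text \<open>\<open>V2, V0, V1\<close> and \<open>U2, U0, U1\<close> stand for the generators with lower indices
  \<open>V\<^sub>2, V\<^sub>0, V\<^sub>1\<close> and upper indices \<open>U\<^sup>2, U\<^sup>0, U\<^sup>1\<close>.\<close>

datatype gen = V2 | U2 | A | B | V0 | V1 | U0 | U1

instance gen :: finite
proof
  have "(UNIV :: gen set) = {V2, U2, A, B, V0, V1, U0, U1}"
    using gen.exhaust by auto
  then show "finite (UNIV :: gen set)"
    by (metis finite.emptyI finite_insert)
qed

type_synonym lalg = "real ^ gen"

abbreviation basis_vec :: "gen \<Rightarrow> lalg" where
  "basis_vec i \<equiv> axis i 1"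

text \<open>Each nonzero bracket of generators is listed in one order only.\<close>

fun half_bracket :: "gen \<Rightarrow> gen \<Rightarrow> lalg" where
  "half_bracket B A = (1 / sqrt 3) *\<^sub>R basis_vec A"
| "half_bracket U2 V2 = basis_vec V2"
| "half_bracket V0 U0 = - basis_vec V2"
| "half_bracket V1 U1 = - basis_vec V2"
| "half_bracket U2 V0 = (1 / 2) *\<^sub>R basis_vec V0"
| "half_bracket U2 V1 = (1 / 2) *\<^sub>R basis_vec V1"
| "half_bracket U2 U0 = (1 / 2) *\<^sub>R basis_vec U0"
| "half_bracket U2 U1 = (1 / 2) *\<^sub>R basis_vec U1"
| "half_bracket B V0 = - (sqrt 3 / 2) *\<^sub>R basis_vec V0"
| "half_bracket B V1 = - (1 / (2 * sqrt 3)) *\<^sub>R basis_vec V1"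
| "half_bracket B U0 = (sqrt 3 / 2) *\<^sub>R basis_vec U0"
| "half_bracket B U1 = (1 / (2 * sqrt 3)) *\<^sub>R basis_vec U1"
| "half_bracket A V0 = basis_vec V1"
| "half_bracket A U1 = - basis_vec U0"
| "half_bracket A V1 = - (2 / sqrt 3) *\<^sub>R basis_vec U1"
| "half_bracket _ _ = 0"

definition lalg_bracket :: "lalg \<Rightarrow> lalg \<Rightarrow> lalg" where
  "lalg_bracket x y =
     (\<Sum>i\<in>UNIV. \<Sum>j\<in>UNIV. (x $ i * y $ j) *\<^sub>R (half_bracket i j - half_bracket j i))"

fun gram_diag :: "real \<Rightarrow> real \<Rightarrow> real \<Rightarrow> gen \<Rightarrow> real" where
  "gram_diag \<epsilon> \<epsilon>1 \<epsilon>2 V2 = - \<epsilon>1"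
| "gram_diag \<epsilon> \<epsilon>1 \<epsilon>2 U2 = 1"
| "gram_diag \<epsilon> \<epsilon>1 \<epsilon>2 A = - \<epsilon>1"
| "gram_diag \<epsilon> \<epsilon>1 \<epsilon>2 B = 1"
| "gram_diag \<epsilon> \<epsilon>1 \<epsilon>2 V0 = - \<epsilon>"
| "gram_diag \<epsilon> \<epsilon>1 \<epsilon>2 V1 = - \<epsilon>2"
| "gram_diag \<epsilon> \<epsilon>1 \<epsilon>2 U0 = - \<epsilon>2"
| "gram_diag \<epsilon> \<epsilon>1 \<epsilon>2 U1 = - \<epsilon>"

definition lalg_scalar_product :: "real \<Rightarrow> real \<Rightarrow> real \<Rightarrow> lalg \<Rightarrow> lalg \<Rightarrow> real" where
  "lalg_scalar_product \<epsilon> \<epsilon>1 \<epsilon>2 x y = (\<Sum>i\<in>UNIV. gram_diag \<epsilon> \<epsilon>1 \<epsilon>2 i * x $ i * y $ i)"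

text \<open>Covariant derivative and curvature operators restricted to the Lie algebra, which is embedded
  into the vector fields by \<open>\<Phi>\<close>.\<close>

definition nabla_op ::
    "('a vfield \<Rightarrow> 'a vfield \<Rightarrow> 'a vfield) \<Rightarrow> (lalg \<Rightarrow> 'a vfield) \<Rightarrow> lalg \<Rightarrow> lalg \<Rightarrow> 'a vfield" where
  "nabla_op D \<Phi> x = (\<lambda>z. D (\<Phi> x) (\<Phi> z))"

definition curvature_op ::
    "('a vfield \<Rightarrow> 'a vfield \<Rightarrow> 'a vfield) \<Rightarrow> (lalg \<Rightarrow> 'a vfield) \<Rightarrow> lalg \<Rightarrow> lalg \<Rightarrow> lalg \<Rightarrow> 'a vfield"
    where
  "curvature_op D \<Phi> x y = (\<lambda>z. curvature D (\<Phi> x) (\<Phi> y) (\<Phi> z))"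

end

(* Left-invariant fields have constant scalar products, and by left translation their values span
   every tangent space. So the Koszul formula determines the Levi-Civita connection on them by an
   algebraic product on the Lie algebra, and each curvature identity becomes an identity between
   vectors of R^8 with coefficients in Q(sqrt 3).
   Left translation preserves tangent vectors, which are derivations of the smooth functions,
   because it preserves smooth functions; this rests on the chain rule for C^k maps. *)

theory Submission
  imports Defs
begin

section \<open>The chain rule for maps of class \<open>C\<^sup>k\<close>\<close>

text \<open>A derivative at a point of an open set depends only on nearby values, so the induction
  passes from \<open>f\<close> to \<open>g\<close>. Chart representatives built with
  \<open>inv_into\<close> agree only on a chart image, hence the freedom outside
  \<open>S\<close>.\<close>

lemma Ck_on_cong:
  assumes "open S" and "\<And>x. x \<in> S \<Longrightarrow> f x = g x" and "Ck_on k S f"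
  shows "Ck_on k S g"
  using assms(2,3)
proof (induction k arbitrary: f g)
  case 0
  then show ?case by (simp cong: continuous_on_cong)
next
  case (Suc k)
  have d: "(g has_derivative frechet_derivative f (at x)) (at x)" if "x \<in> S" for x
    using Suc.prems that assms(1) has_derivative_transform_within_open[of f _ x UNIV S g]
    by (auto simp: frechet_derivative_works)
  have "frechet_derivative f (at x) h = frechet_derivative g (at x) h" if "x \<in> S" for x h
    by (rule fun_cong[OF frechet_derivative_at[OF d[OF that]]])
  moreover have "Ck_on k S (\<lambda>x. frechet_derivative f (at x) h)" for h
    using Suc.prems(2) by simp
  ultimately have "Ck_on k S (\<lambda>x. frechet_derivative g (at x) h)" for h
    by (rule Suc.IH)
  then show ?case using d by (auto simp: differentiable_def)
qed

text \<open>Derivatives are unique, so an explicitly computed \<open>f'\<close> may replace the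
  chosen \<open>frechet_derivative\<close>; the product and chain rules enter through this
  form.\<close>

lemma Ck_on_SucI:
  assumes "open S" and d: "\<And>x. x \<in> S \<Longrightarrow> (f has_derivative f' x) (at x)"
    and "\<And>h. Ck_on k S (\<lambda>x. f' x h)"
  shows "Ck_on (Suc k) S f"
proof -
  have "Ck_on k S (\<lambda>x. frechet_derivative f (at x) h)" for h
    using assms(3)[of h] frechet_derivative_at[OF d]
    by (intro Ck_on_cong[OF assms(1) _ assms(3)[of h]]) auto
  then show ?thesis using d by (auto simp: differentiable_def)
qed

lemma Ck_on_Suc_has_derivative:
  "Ck_on (Suc k) S f \<Longrightarrow> x \<in> S \<Longrightarrow> (f has_derivative frechet_derivative f (at x)) (at x)"
  by (rule iffD1[OF frechet_derivative_works]) simp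

lemma Ck_on_Suc_imp: "Ck_on (Suc k) S f \<Longrightarrow> Ck_on k S f"
proof (induction k arbitrary: f)
  case 0
  then show ?case
    by (auto intro: continuous_at_imp_continuous_on differentiable_imp_continuous_within)
next
  case (Suc k)
  have "Ck_on k S (\<lambda>x. frechet_derivative f (at x) h)" for h
    using Suc.prems by (intro Suc.IH) simp
  then show ?case using Suc.prems by simp
qed

text \<open>Continuity at a point and derivatives see only neighbourhoods. This serves where the
  chart around \<open>a \<otimes> p\<close> changes with \<open>p\<close> and smoothness is known
  only near each point.\<close>

lemma Ck_on_local:
  assumes "\<And>x. x \<in> S \<Longrightarrow> \<exists>T. open T \<and> x \<in> T \<and> Ck_on k T f"
  shows "Ck_on k S f"
  using assms
proof (induction k arbitrary: f)
  case 0
  have "isCont f x" if "x \<in> S" for x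
    using 0[OF that] by (auto simp: continuous_on_eq_continuous_at)
  then show ?case by (simp add: continuous_at_imp_continuous_on)
next
  case (Suc k)
  have "Ck_on k S (\<lambda>x. frechet_derivative f (at x) h)" for h
  proof (rule Suc.IH)
    show "\<exists>T. open T \<and> x \<in> T \<and> Ck_on k T (\<lambda>x. frechet_derivative f (at x) h)" if "x \<in> S" for x
      using Suc.prems[OF that] by auto
  qed
  moreover have "f differentiable (at x)" if "x \<in> S" for x
    using Suc.prems[OF that] by auto
  ultimately show ?case by simp
qed

section \<open>Algebraic operations and composition\<close>

lemma Ck_on_const: "Ck_on k S (\<lambda>x. c)"
proof (induction k arbitrary: c)
  case (Suc k)
  then show ?case by (simp add: frechet_derivative_const)
qed simp

lemma Ck_on_add:
  assumes "open S" "Ck_on k S f" "Ck_on k S g"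
  shows "Ck_on k S (\<lambda>x. f x + g x)"
  using assms(2,3)
proof (induction k arbitrary: f g)
  case 0
  then show ?case by (simp add: continuous_on_add)
next
  case (Suc k)
  show ?case
  proof (rule Ck_on_SucI[OF assms(1)])
    show "((\<lambda>x. f x + g x) has_derivative
        (\<lambda>h. frechet_derivative f (at x) h + frechet_derivative g (at x) h)) (at x)" if "x \<in> S" for x
      using that Suc.prems by (intro has_derivative_add Ck_on_Suc_has_derivative)
  qed (use Suc in simp)
qed

lemma Ck_on_sum:
  assumes "open S" "\<And>i. i \<in> I \<Longrightarrow> Ck_on k S (f i)"
  shows "Ck_on k S (\<lambda>x. \<Sum>i\<in>I. f i x)"
  using assms(2)
  by (induction I rule: infinite_finite_induct) (simp_all add: Ck_on_const Ck_on_add[OF assms(1)])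

lemma Ck_on_bounded_linear:
  assumes "open S" "bounded_linear L" "Ck_on k S f"
  shows "Ck_on k S (\<lambda>x. L (f x))"
  using assms(3)
proof (induction k arbitrary: f)
  case 0
  then show ?case using bounded_linear.continuous_on[OF assms(2)] by auto
next
  case (Suc k)
  show ?case
  proof (rule Ck_on_SucI[OF assms(1)])
    show "((\<lambda>x. L (f x)) has_derivative (\<lambda>h. L (frechet_derivative f (at x) h))) (at x)"
      if "x \<in> S" for x
      using that Suc.prems
      by (intro bounded_linear.has_derivative[OF assms(2)] Ck_on_Suc_has_derivative)
  qed (use Suc in simp)
qed

lemma Ck_on_scaleR:
  assumes "open S" "Ck_on k S f" "Ck_on k S g"
  shows "Ck_on k S (\<lambda>x. f x *\<^sub>R g x)"
  using assms(2,3)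
proof (induction k arbitrary: f g)
  case 0
  then show ?case by (simp add: continuous_on_scaleR)
next
  case (Suc k)
  show ?case
  proof (rule Ck_on_SucI[OF assms(1)])
    show "((\<lambda>x. f x *\<^sub>R g x) has_derivative
        (\<lambda>h. f x *\<^sub>R frechet_derivative g (at x) h + frechet_derivative f (at x) h *\<^sub>R g x)) (at x)"
      if "x \<in> S" for x
      using that Suc.prems by (intro has_derivative_scaleR Ck_on_Suc_has_derivative)
    show "Ck_on k S (\<lambda>x. f x *\<^sub>R frechet_derivative g (at x) h + frechet_derivative f (at x) h *\<^sub>R g x)"
      for h
      \<comment> \<open>The product rule leaves one factor undifferentiated; it is lowered from
        class C^(k+1) to C^k so that the induction hypothesis applies to each product.\<close>
      using Suc.prems Ck_on_Suc_imp[of k S f] Ck_on_Suc_imp[of k S g]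
      by (intro Ck_on_add[OF assms(1)] Suc.IH) simp_all
  qed
qed

text \<open>The chain rule evaluates the derivative of \<open>f\<close> in the direction
  \<open>frechet_derivative h (at x) v\<close>, which varies with \<open>x\<close>, whereas
  \<open>Ck_on\<close> controls fixed directions only. Expanding that direction in
  \<open>Basis\<close> gives a finite sum of products of functions of class C^k.\<close>

lemma Ck_on_compose:
  fixes h :: "'a::euclidean_space \<Rightarrow> 'b::euclidean_space"
  assumes "open S" "Ck_on k T f" "Ck_on k S h" "h ` S \<subseteq> T"
  shows "Ck_on k S (\<lambda>x. f (h x))"
  using assms(2,3)
proof (induction k arbitrary: f)
  case 0
  then show ?case using assms(4) by (auto intro: continuous_on_compose2)
next
  case (Suc k)
  show ?case
  proof (rule Ck_on_SucI[OF assms(1)])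
    fix x assume x: "x \<in> S"
    let ?f' = "frechet_derivative f (at (h x))" and ?h' = "frechet_derivative h (at x)"
    have f': "(f has_derivative ?f') (at (h x))"
      using x assms(4) by (intro Ck_on_Suc_has_derivative[OF Suc.prems(1)]) auto
    then interpret f': linear ?f'
      by (rule has_derivative_linear)
    have f'_sum: "?f' w = (\<Sum>b\<in>Basis. (w \<bullet> b) *\<^sub>R ?f' b)" for w
    proof -
      have "?f' (\<Sum>b\<in>Basis. (w \<bullet> b) *\<^sub>R b) = (\<Sum>b\<in>Basis. (w \<bullet> b) *\<^sub>R ?f' b)"
        by (simp add: f'.sum f'.scale)
      then show ?thesis by (simp only: euclidean_representation)
    qed
    show "((\<lambda>x. f (h x)) has_derivative
        (\<lambda>v. \<Sum>b\<in>Basis. (?h' v \<bullet> b) *\<^sub>R ?f' b)) (at x)"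
      unfolding f'_sum[symmetric]
      using Ck_on_Suc_has_derivative[OF Suc.prems(2) x] f'
      by (rule has_derivative_compose)
  next
    fix v
    show "Ck_on k S (\<lambda>x. \<Sum>b\<in>Basis.
        (frechet_derivative h (at x) v \<bullet> b) *\<^sub>R frechet_derivative f (at (h x)) b)"
    proof (intro Ck_on_sum[OF assms(1)] Ck_on_scaleR[OF assms(1)])
      fix b
      show "Ck_on k S (\<lambda>x. frechet_derivative h (at x) v \<bullet> b)"
        using Suc.prems(2) by (intro Ck_on_bounded_linear[OF assms(1) bounded_linear_inner_left]) simp
      \<comment> \<open>The induction varies \<open>f\<close> and fixes \<open>h\<close>, so its
        hypothesis covers the derivative of \<open>f\<close> in the fixed direction
        \<open>b\<close>, composed with \<open>h\<close>.\<close>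
      show "Ck_on k S (\<lambda>x. frechet_derivative f (at (h x)) b)"
        using Suc.prems(1)
        by (intro Suc.IH[of "\<lambda>y. frechet_derivative f (at y) b"] Ck_on_Suc_imp[OF Suc.prems(2)]) simp
    qed
  qed
qed

text \<open>Freezes the first factor of the group multiplication, of which left translation is a
  slice.\<close>

lemma Ck_on_Pair_const:
  assumes "open S"
  shows "Ck_on k S (\<lambda>x. (c, x))"
proof (cases k)
  case 0
  then show ?thesis by (simp add: continuous_on_Pair)
next
  case (Suc m)
  have "((\<lambda>x. (c, x)) has_derivative (\<lambda>h. (0, h))) (at x)" for x :: 'a
    by (auto intro!: derivative_eq_intros)
  then show ?thesis
    unfolding Suc by (intro Ck_on_SucI[OF assms]) (auto simp: Ck_on_const)
qed

section \<open>Left-invariant fields and the Levi-Civita connection\<close>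

lemma smooth_atlas_chart_at:
  assumes "smooth_atlas \<A>"
  obtains U \<phi> where "(U, \<phi>) \<in> \<A>" "p \<in> U" "open U" "open (\<phi> ` U)"
    "homeomorphism U (\<phi> ` U) \<phi> (inv_into U \<phi>)"
proof -
  have "p \<in> (\<Union>(U, \<phi>)\<in>\<A>. U)"
    using assms by (simp add: smooth_atlas_def)
  then obtain U \<phi> where "(U, \<phi>) \<in> \<A>" "p \<in> U" by auto
  then show ?thesis using assms that by (auto simp: smooth_atlas_def)
qed

lemma lie_group_mult_smooth:
  assumes "lie_group G \<A>" "(U, \<phi>) \<in> \<A>" "(V, \<psi>) \<in> \<A>" "(W, \<theta>) \<in> \<A>"
  shows "smooth_on {(\<phi> p, \<psi> q) | p q. p \<in> U \<and> q \<in> V \<and> p \<otimes>\<^bsub>G\<^esub> q \<in> W}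
    (\<lambda>(x, y). \<theta> (inv_into U \<phi> x \<otimes>\<^bsub>G\<^esub> inv_into V \<psi> y))"
proof -
  have *: "\<forall>(U, \<phi>)\<in>\<A>. \<forall>(V, \<psi>)\<in>\<A>. \<forall>(W, \<theta>)\<in>\<A>.
      smooth_on {(\<phi> p, \<psi> q) | p q. p \<in> U \<and> q \<in> V \<and> p \<otimes>\<^bsub>G\<^esub> q \<in> W}
        (\<lambda>(x, y). \<theta> (inv_into U \<phi> x \<otimes>\<^bsub>G\<^esub> inv_into V \<psi> y))"
    using assms(1) unfolding lie_group_def by (elim conjE)
  show ?thesis
    by (rule *[THEN bspec, OF assms(2), THEN case_prodD, THEN bspec, OF assms(3), THEN case_prodD,
          THEN bspec, OF assms(4), THEN case_prodD])
qed

text \<open>In charts around \<open>p\<close> and \<open>a \<otimes> p\<close>, left translation is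
  the slice at \<open>\<psi> a\<close> of a representative of the multiplication. Locally the
  translated function is \<open>f\<close> in the second chart composed with this slice, and the
  chain rule applies.\<close>

lemma smooth_functions_left_translation:
  fixes G :: "('a::{t2_space, second_countable_topology}, 'm) monoid_scheme"
    and \<A> :: "('a, 'e::euclidean_space) chart set"
  assumes G: "lie_group G \<A>" and f: "f \<in> smooth_functions \<A>"
  shows "(\<lambda>q. f (a \<otimes>\<^bsub>G\<^esub> q)) \<in> smooth_functions \<A>"
proof -
  have atlas: "smooth_atlas \<A>"
    and cont: "continuous_on UNIV (\<lambda>(p, q). p \<otimes>\<^bsub>G\<^esub> q)"
    using G by (simp_all add: lie_group_def)
  have "Ck_on k (\<phi> ` U) ((\<lambda>q. f (a \<otimes>\<^bsub>G\<^esub> q)) \<circ> inv_into U \<phi>)" if U: "(U, \<phi>) \<in> \<A>" for U \<phi> k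
  proof (rule Ck_on_local)
    fix x assume "x \<in> \<phi> ` U"
    then obtain p where p: "p \<in> U" "x = \<phi> p" by blast
    have "open U" "open (\<phi> ` U)" and hom: "homeomorphism U (\<phi> ` U) \<phi> (inv_into U \<phi>)"
      using U atlas by (auto simp: smooth_atlas_def)
    note inv\<phi> = homeomorphism_apply1[OF hom]
    obtain V \<psi> where V: "(V, \<psi>) \<in> \<A>" "a \<in> V" "homeomorphism V (\<psi> ` V) \<psi> (inv_into V \<psi>)"
      using atlas by (rule smooth_atlas_chart_at)
    obtain W \<theta> where W: "(W, \<theta>) \<in> \<A>" "a \<otimes>\<^bsub>G\<^esub> p \<in> W" "open W"
        "homeomorphism W (\<theta> ` W) \<theta> (inv_into W \<theta>)"
      using atlas by (rule smooth_atlas_chart_at)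
    \<comment> \<open>The part of \<open>U\<close> that \<open>a\<close> translates into the chart
      domain \<open>W\<close>. Its image under \<phi> is open, and the composition is defined on
      it.\<close>
    define T where "T = {q \<in> U. a \<otimes>\<^bsub>G\<^esub> q \<in> W}"
    have "continuous_on UNIV (\<lambda>q. a \<otimes>\<^bsub>G\<^esub> q)"
      using continuous_on_compose2[OF cont, of UNIV "\<lambda>q. (a, q)"]
      by (simp add: continuous_on_Pair)
    then have "open ((\<lambda>q. a \<otimes>\<^bsub>G\<^esub> q) -` W)"
      using \<open>open W\<close> by (simp add: open_vimage)
    then have "openin (top_of_set U) T"
      by (auto simp: T_def openin_open)
    then have "openin (top_of_set (\<phi> ` U)) (\<phi> ` T)"
      using homeomorphism_imp_open_map[OF hom] by blast
    then have op: "open (\<phi> ` T)"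
      using \<open>open (\<phi> ` U)\<close> by (rule openin_open_trans)
    define F where "F = (\<lambda>(x, y). \<theta> (inv_into V \<psi> x \<otimes>\<^bsub>G\<^esub> inv_into U \<phi> y))"
    have F: "Ck_on k {(\<psi> p, \<phi> q) | p q. p \<in> V \<and> q \<in> U \<and> p \<otimes>\<^bsub>G\<^esub> q \<in> W} F"
      using lie_group_mult_smooth[OF G V(1) U W(1)] by (simp add: smooth_on_def F_def)
    have "Ck_on k (\<phi> ` T) (\<lambda>y. F (\<psi> a, y))"
      by (rule Ck_on_compose[OF op F Ck_on_Pair_const[OF op]]) (use V(2) in \<open>auto simp: T_def\<close>)
    moreover have "Ck_on k (\<theta> ` W) (f \<circ> inv_into W \<theta>)"
      using f W(1) by (auto simp: smooth_functions_def smooth_on_def)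
    moreover have F_eq: "F (\<psi> a, \<phi> q) = \<theta> (a \<otimes>\<^bsub>G\<^esub> q)" if "q \<in> U" for q
      unfolding F_def by (simp add: inv\<phi>[OF that] homeomorphism_apply1[OF V(3,2)])
    then have "(\<lambda>y. F (\<psi> a, y)) ` \<phi> ` T \<subseteq> \<theta> ` W"
      by (auto simp: T_def)
    ultimately have "Ck_on k (\<phi> ` T) (\<lambda>y. (f \<circ> inv_into W \<theta>) (F (\<psi> a, y)))"
      using Ck_on_compose[OF op, of k "\<theta> ` W" "f \<circ> inv_into W \<theta>" "\<lambda>y. F (\<psi> a, y)"] by blast
    \<comment> \<open>The composite is known to be the translated function only on the image of
      \<open>T\<close>, where \<open>inv_into\<close> undoes the charts.\<close>
    then have "Ck_on k (\<phi> ` T) ((\<lambda>q. f (a \<otimes>\<^bsub>G\<^esub> q)) \<circ> inv_into U \<phi>)"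
    proof (rule Ck_on_cong[OF op, rotated])
      fix y assume "y \<in> \<phi> ` T"
      then obtain q where q: "q \<in> U" "a \<otimes>\<^bsub>G\<^esub> q \<in> W" "y = \<phi> q" by (auto simp: T_def)
      then show "(f \<circ> inv_into W \<theta>) (F (\<psi> a, y)) =
          ((\<lambda>q. f (a \<otimes>\<^bsub>G\<^esub> q)) \<circ> inv_into U \<phi>) y"
        by (simp add: F_eq inv\<phi> homeomorphism_apply1[OF W(4)])
    qed
    then show "\<exists>S. open S \<and> x \<in> S \<and> Ck_on k S ((\<lambda>q. f (a \<otimes>\<^bsub>G\<^esub> q)) \<circ> inv_into U \<phi>)"
      using op p W(2) by (auto simp: T_def)
  qed
  then show ?thesis
    by (auto simp: smooth_functions_def smooth_on_def)
qed

section \<open>Tangent vectors and their left translates\<close>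

text \<open>The square of the constant function is also its multiple by the scalar \<open>c\<close>,
  so Leibniz and homogeneity give \<open>2 * c * v (\<lambda>_. c) = c * v (\<lambda>_. c)\<close>.
  For \<open>c = 0\<close> homogeneity with scalar 0 suffices, and off the smooth functions
  \<open>v\<close> vanishes by convention.\<close>

lemma tangent_space_const:
  assumes "v \<in> tangent_space \<A> p"
  shows "v (\<lambda>_. c) = 0"
proof (cases "(\<lambda>_. c) \<in> smooth_functions \<A>")
  case True
  have "(\<lambda>_. c) * (\<lambda>_. c) = c *\<^sub>R (\<lambda>_. c)"
    by (simp add: fun_eq_iff scaleR_fun_def)
  moreover have "v ((\<lambda>_. c) * (\<lambda>_. c)) = c * v (\<lambda>_. c) + c * v (\<lambda>_. c)"
    using assms True by (simp add: tangent_space_def)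
  moreover have "v (c *\<^sub>R (\<lambda>_. c)) = c * v (\<lambda>_. c)"
    using assms True unfolding tangent_space_def by blast
  ultimately have "c * v (\<lambda>_. c) + c * v (\<lambda>_. c) = c * v (\<lambda>_. c)" by metis
  then have "c * v (\<lambda>_. c) = 0" by simp
  moreover have "v (0 *\<^sub>R (\<lambda>_. c)) = 0 * v (\<lambda>_. c)"
    using assms True unfolding tangent_space_def by blast
  ultimately show ?thesis
    by (cases "c = 0") (simp_all add: zero_fun_def)
next
  case False
  then show ?thesis using assms by (auto simp: tangent_space_def)
qed

lemma tangent_space_add:
  "u \<in> tangent_space \<A> p \<Longrightarrow> v \<in> tangent_space \<A> p \<Longrightarrow> u + v \<in> tangent_space \<A> p"
  by (simp add: tangent_space_def algebra_simps)

lemma tangent_space_scaleR: "v \<in> tangent_space \<A> p \<Longrightarrow> c *\<^sub>R v \<in> tangent_space \<A> p"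
  by (simp add: tangent_space_def scaleR_fun_def algebra_simps)

lemma tangent_space_diff:
  "u \<in> tangent_space \<A> p \<Longrightarrow> v \<in> tangent_space \<A> p \<Longrightarrow> u - v \<in> tangent_space \<A> p"
  using tangent_space_add[of u \<A> p "(-1) *\<^sub>R v"] tangent_space_scaleR[of v \<A> p "-1"] by simp

lemma left_push_left_push:
  assumes "lie_group G \<A>"
  shows "left_push G a (left_push G b v) = left_push G (a \<otimes>\<^bsub>G\<^esub> b) v"
proof -
  interpret group G using assms by (simp add: lie_group_def)
  have "carrier G = UNIV" using assms by (simp add: lie_group_def)
  then show ?thesis by (simp add: left_push_def m_assoc)
qed

lemma left_push_one:
  assumes "lie_group G \<A>"
  shows "left_push G \<one>\<^bsub>G\<^esub> v = v"
proof -
  interpret group G using assms by (simp add: lie_group_def)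
  have "carrier G = UNIV" using assms by (simp add: lie_group_def)
  then show ?thesis by (simp add: left_push_def)
qed

text \<open>Pullback along a left translation respects sums and products of smooth functions, and
  the pullback at \<open>p\<close> has the value of the function at \<open>a \<otimes> p\<close>; so
  derivations go to derivations.\<close>

lemma left_push_tangent_space:
  fixes G :: "('a::{t2_space, second_countable_topology}, 'm) monoid_scheme"
    and \<A> :: "('a, 'e::euclidean_space) chart set"
  assumes G: "lie_group G \<A>" and v: "v \<in> tangent_space \<A> p"
  shows "left_push G a v \<in> tangent_space \<A> (a \<otimes>\<^bsub>G\<^esub> p)"
proof -
  interpret group G using G by (simp add: lie_group_def)
  have carrier: "carrier G = UNIV" using G by (simp add: lie_group_def)
  have "left_push G a v f = 0" if "f \<notin> smooth_functions \<A>" for f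
  proof -
    \<comment> \<open>Vanishing off the smooth functions needs the converse: a smooth translate
      could be translated back by the inverse of \<open>a\<close>, making \<open>f\<close>
      smooth.\<close>
    have "(\<lambda>q. f (a \<otimes>\<^bsub>G\<^esub> q)) \<notin> smooth_functions \<A>"
    proof
      assume "(\<lambda>q. f (a \<otimes>\<^bsub>G\<^esub> q)) \<in> smooth_functions \<A>"
      from smooth_functions_left_translation[OF G this, of "inv\<^bsub>G\<^esub> a"]
      have "(\<lambda>q. f (a \<otimes>\<^bsub>G\<^esub> (inv\<^bsub>G\<^esub> a \<otimes>\<^bsub>G\<^esub> q))) \<in> smooth_functions \<A>" .
      moreover have "a \<otimes>\<^bsub>G\<^esub> (inv\<^bsub>G\<^esub> a \<otimes>\<^bsub>G\<^esub> q) = q" for q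
        using carrier by (simp add: m_assoc[symmetric])
      ultimately show False using that by simp
    qed
    then show ?thesis using v by (simp add: tangent_space_def left_push_def)
  qed
  moreover have "left_push G a v (c *\<^sub>R f) = c * left_push G a v f"
    if "f \<in> smooth_functions \<A>" for c f
  proof -
    have "v (c *\<^sub>R (\<lambda>q. f (a \<otimes>\<^bsub>G\<^esub> q))) = c * v (\<lambda>q. f (a \<otimes>\<^bsub>G\<^esub> q))"
      using smooth_functions_left_translation[OF G that] v unfolding tangent_space_def by blast
    then show ?thesis by (simp add: left_push_def scaleR_fun_def)
  qed
  moreover have "left_push G a v (f + h) = left_push G a v f + left_push G a v h \<and>
      left_push G a v (f * h) = f (a \<otimes>\<^bsub>G\<^esub> p) * left_push G a v h + h (a \<otimes>\<^bsub>G\<^esub> p) * left_push G a v f"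
    if "f \<in> smooth_functions \<A>" "h \<in> smooth_functions \<A>" for f h
  proof -
    let ?f = "\<lambda>q. f (a \<otimes>\<^bsub>G\<^esub> q)" and ?h = "\<lambda>q. h (a \<otimes>\<^bsub>G\<^esub> q)"
    have "v (?f + ?h) = v ?f + v ?h" "v (?f * ?h) = ?f p * v ?h + ?h p * v ?f"
      using smooth_functions_left_translation[OF G that(1)]
        smooth_functions_left_translation[OF G that(2)] v
      unfolding tangent_space_def by blast+
    then show ?thesis by (simp add: left_push_def plus_fun_def times_fun_def)
  qed
  ultimately show ?thesis unfolding tangent_space_def by blast
qed

section \<open>Left-invariant fields, metrics and connections\<close>

lemma left_invariant_fieldsD:
  assumes G: "lie_group G \<A>" and X: "X \<in> left_invariant_fields G \<A>"
  shows "X p = left_push G p (X \<one>\<^bsub>G\<^esub>)"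
proof -
  interpret group G using G by (simp add: lie_group_def)
  have "carrier G = UNIV" using G by (simp add: lie_group_def)
  then have "p \<otimes>\<^bsub>G\<^esub> \<one>\<^bsub>G\<^esub> = p" by simp
  then show ?thesis using X unfolding left_invariant_fields_def by (metis (mono_tags, lifting) mem_Collect_eq)
qed

text \<open>Translate \<open>v\<close> back to the identity, where evaluation is onto, and push the
  value found there forward to \<open>p\<close>. Non-degeneracy at \<open>p\<close> can then be
  tested on left-invariant fields.\<close>

lemma identification_surj_tangent_space:
  fixes G :: "('a::{t2_space, second_countable_topology}, 'm) monoid_scheme"
    and \<A> :: "('a, 'e::euclidean_space) chart set"
  assumes G: "lie_group G \<A>" and \<Phi>: "lie_algebra_identification G \<A> br \<Phi>"
    and v: "v \<in> tangent_space \<A> p"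
  shows "\<exists>x. v = \<Phi> x p"
proof -
  interpret group G using G by (simp add: lie_group_def)
  have carrier: "carrier G = UNIV" using G by (simp add: lie_group_def)
  have "left_push G (inv\<^bsub>G\<^esub> p) v \<in> tangent_space \<A> \<one>\<^bsub>G\<^esub>"
    using left_push_tangent_space[OF G v, of "inv\<^bsub>G\<^esub> p"] carrier by simp
  then obtain x where x: "left_push G (inv\<^bsub>G\<^esub> p) v = \<Phi> x \<one>\<^bsub>G\<^esub>"
    using \<Phi> unfolding lie_algebra_identification_def bij_betw_def by blast
  have "\<Phi> x \<in> left_invariant_fields G \<A>"
    using \<Phi> by (simp add: lie_algebra_identification_def)
  then have "\<Phi> x p = left_push G p (left_push G (inv\<^bsub>G\<^esub> p) v)"
    using left_invariant_fieldsD[OF G] x by metis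
  also have "\<dots> = v"
    using carrier by (simp add: left_push_left_push[OF G] left_push_one[OF G])
  finally show ?thesis by metis
qed

text \<open>Both values at \<open>p\<close> are left translates of those at the identity, and left
  translation is an isometry.\<close>

lemma left_invariant_metric_eq:
  assumes G: "lie_group G \<A>" and g: "left_invariant_metric G \<A> g"
    and X: "X \<in> left_invariant_fields G \<A>" and Y: "Y \<in> left_invariant_fields G \<A>"
  shows "g p (X p) (Y p) = g \<one>\<^bsub>G\<^esub> (X \<one>\<^bsub>G\<^esub>) (Y \<one>\<^bsub>G\<^esub>)"
proof -
  interpret group G using G by (simp add: lie_group_def)
  have "carrier G = UNIV" using G by (simp add: lie_group_def)
  then have "p \<otimes>\<^bsub>G\<^esub> \<one>\<^bsub>G\<^esub> = p" by simp
  moreover have "X \<one>\<^bsub>G\<^esub> \<in> tangent_space \<A> \<one>\<^bsub>G\<^esub>" "Y \<one>\<^bsub>G\<^esub> \<in> tangent_space \<A> \<one>\<^bsub>G\<^esub>"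
    using X Y by (auto simp: left_invariant_fields_def vector_fields_def)
  ultimately show ?thesis
    using g left_invariant_fieldsD[OF G X, of p] left_invariant_fieldsD[OF G Y, of p]
    unfolding left_invariant_metric_def by metis
qed

text \<open>The difference of both sides is symmetric in its first two arguments and, paired with a third
  left-invariant field, skew in its last two; such a trilinear form vanishes.\<close>

lemma levi_civita_left_invariant:
  fixes G :: "('a::{t2_space, second_countable_topology}, 'm) monoid_scheme"
    and \<A> :: "('a, 'e::euclidean_space) chart set"
    and br nab :: "'v::real_vector \<Rightarrow> 'v \<Rightarrow> 'v" and sp :: "'v \<Rightarrow> 'v \<Rightarrow> real"
  assumes G: "lie_group G \<A>" and \<Phi>: "lie_algebra_identification G \<A> br \<Phi>"
    and g: "left_invariant_metric G \<A> g"
    and sp: "\<And>x y. g \<one>\<^bsub>G\<^esub> (\<Phi> x \<one>\<^bsub>G\<^esub>) (\<Phi> y \<one>\<^bsub>G\<^esub>) = sp x y"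
    and D: "levi_civita_connection \<A> g D"
    and torsion: "\<And>x y. nab x y - nab y x = br x y"
    and metric: "\<And>x y z. sp (nab x y) z + sp y (nab x z) = 0"
  shows "D (\<Phi> x) (\<Phi> y) = \<Phi> (nab x y)"
proof
  fix p
  have inv: "\<Phi> x \<in> left_invariant_fields G \<A>" for x
    using \<Phi> by (simp add: lie_algebra_identification_def)
  then have vf: "\<Phi> x \<in> vector_fields \<A>" for x
    by (simp add: left_invariant_fields_def)
  then have vfD: "D (\<Phi> x) (\<Phi> y) \<in> vector_fields \<A>" for x y
    using D unfolding levi_civita_connection_def affine_connection_def by blast
  have T: "\<Phi> x p \<in> tangent_space \<A> p" "D (\<Phi> x) (\<Phi> y) p \<in> tangent_space \<A> p" for x y
    using vf vfD by (auto simp: vector_fields_def)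
  have g_sym: "g p u v = g p v u" and g_scale: "g p (c *\<^sub>R u) v = c * g p u v"
    if "u \<in> tangent_space \<A> p" "v \<in> tangent_space \<A> p" for u v c
    using that g unfolding left_invariant_metric_def pseudo_riemannian_metric_def by blast+
  have g_add: "g p (u + w) v = g p u v + g p w v"
    if "u \<in> tangent_space \<A> p" "v \<in> tangent_space \<A> p" "w \<in> tangent_space \<A> p" for u v w
    using that g unfolding left_invariant_metric_def pseudo_riemannian_metric_def by blast
  have g_diff: "g p (u - w) v = g p u v - g p w v"
    if "u \<in> tangent_space \<A> p" "v \<in> tangent_space \<A> p" "w \<in> tangent_space \<A> p" for u v w
    using g_add[OF that(1,2) tangent_space_scaleR[OF that(3), of "-1"]] g_scale[OF that(3,2), of "-1"]
    by simp
  have g_\<Phi>: "g q (\<Phi> x q) (\<Phi> y q) = sp x y" for q x y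
    using left_invariant_metric_eq[OF G g inv inv] sp by simp
  define h where "h x y z = g p (D (\<Phi> x) (\<Phi> y) p) (\<Phi> z p) - sp (nab x y) z" for x y z
  have h_skew: "h x y z = - h x z y" for x y z
  proof -
    have "\<Phi> x p (\<lambda>q. g q (\<Phi> y q) (\<Phi> z q)) =
        g p (D (\<Phi> x) (\<Phi> y) p) (\<Phi> z p) + g p (\<Phi> y p) (D (\<Phi> x) (\<Phi> z) p)"
      using D vf unfolding levi_civita_connection_def by blast
    \<comment> \<open>By left-invariance the differentiated function is the constant
      \<open>sp y z\<close>, so metric compatibility of \<open>D\<close> takes the same form as that
      of \<open>nab\<close>.\<close>
    moreover have "\<Phi> x p (\<lambda>q. g q (\<Phi> y q) (\<Phi> z q)) = 0"
      by (simp add: g_\<Phi> tangent_space_const[OF T(1)])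
    moreover have "sp y (nab x z) = sp (nab x z) y"
      using g_sym[OF T(1) T(1)] by (simp add: g_\<Phi>)
    ultimately show ?thesis
      using metric[of x y z] g_sym[OF T(1) T(2), of y x z] by (simp add: h_def)
  qed
  have h_sym: "h x y z = h y x z" for x y z
  proof -
    \<comment> \<open>The torsion conditions on \<open>D\<close> and \<open>nab\<close> involve the
      same bracket \<open>br x y\<close>, so the parts skew in \<open>x\<close> and \<open>y\<close>
      cancel in \<open>h\<close>.\<close>
    have "D (\<Phi> x) (\<Phi> y) - D (\<Phi> y) (\<Phi> x) = \<Phi> (br x y)"
      using D vf \<Phi> unfolding levi_civita_connection_def lie_algebra_identification_def by metis
    then have "D (\<Phi> x) (\<Phi> y) p - D (\<Phi> y) (\<Phi> x) p = \<Phi> (br x y) p"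
      by (metis minus_apply)
    then have "g p (D (\<Phi> x) (\<Phi> y) p) (\<Phi> z p) - g p (D (\<Phi> y) (\<Phi> x) p) (\<Phi> z p) = sp (br x y) z"
      using g_diff[OF T(2) T(1) T(2)] g_\<Phi> by metis
    moreover have "linear \<Phi>"
      using \<Phi> by (simp add: lie_algebra_identification_def)
    then have "\<Phi> (br x y) p = \<Phi> (nab x y) p - \<Phi> (nab y x) p"
      by (simp add: torsion[symmetric] linear_diff)
    then have "sp (br x y) z = sp (nab x y) z - sp (nab y x) z"
      using g_diff[OF T(1) T(1) T(1)] g_\<Phi> by metis
    ultimately show ?thesis by (simp add: h_def)
  qed
  \<comment> \<open>Alternate the two symmetries: h x y z = - h x z y = - h z x y = h z y x = h y z
    x = - h y x z = - h x y z.\<close>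
  have h_0: "h x y z = 0" for z
    using h_skew[of x y z] h_sym[of x z y] h_skew[of z x y] h_sym[of z y x] h_skew[of y z x]
      h_sym[of y x z] by linarith
  \<comment> \<open>Left-invariant fields take every tangent value at \<open>p\<close>, so
    non-degeneracy turns the vanishing of \<open>h\<close> into equality of tangent vectors.\<close>
  have "g p (D (\<Phi> x) (\<Phi> y) p - \<Phi> (nab x y) p) v = 0" if "v \<in> tangent_space \<A> p" for v
    using identification_surj_tangent_space[OF G \<Phi> that] h_0 g_diff[OF T(2) T(1) T(1)]
    by (auto simp: h_def g_\<Phi>)
  then have "D (\<Phi> x) (\<Phi> y) p - \<Phi> (nab x y) p = 0"
    using g tangent_space_diff[OF T(2) T(1)]
    unfolding left_invariant_metric_def pseudo_riemannian_metric_def by blast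
  then show "D (\<Phi> x) (\<Phi> y) p = \<Phi> (nab x y) p" by simp
qed

section \<open>The product and the curvature on the Lie algebra\<close>

lemma UNIV_gen: "UNIV = {V2, U2, A, B, V0, V1, U0, U1}"
  using gen.exhaust by auto

lemma sum_gen:
  "(\<Sum>i\<in>UNIV. f i) = f V2 + f U2 + f A + f B + f V0 + f V1 + f U0 + (f U1 :: 'b::comm_monoid_add)"
  by (simp add: UNIV_gen ac_simps)

lemma lalg_eqI:
  fixes x y :: lalg
  assumes "x $ V2 = y $ V2" "x $ U2 = y $ U2" "x $ A = y $ A" "x $ B = y $ B"
    "x $ V0 = y $ V0" "x $ V1 = y $ V1" "x $ U0 = y $ U0" "x $ U1 = y $ U1"
  shows "x = y"
  unfolding vec_eq_iff
proof
  show "x $ i = y $ i" for i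
    by (cases i) (simp_all only: assms)
qed

text \<open>Denominators are rationalised so that coefficients in Q(sqrt 3) have one normal
  form.\<close>

lemma inverse_sqrt_3:
  "1 / sqrt 3 = sqrt 3 / 3" "2 / sqrt 3 = 2 * sqrt 3 / 3" "1 / (2 * sqrt 3) = sqrt 3 / 6"
  by (simp_all add: field_simps)

lemma lalg_bracket_nth:
  "lalg_bracket x y $ V2 = - x $ V2 * y $ U2 + x $ U2 * y $ V2 - x $ V0 * y $ U0 - x $ V1 * y $ U1 + x $ U0 * y $ V0 + x $ U1 * y $ V1"
  "lalg_bracket x y $ U2 = 0"
  "lalg_bracket x y $ A = - sqrt 3 * x $ A * y $ B / 3 + sqrt 3 * x $ B * y $ A / 3"
  "lalg_bracket x y $ B = 0"
  "lalg_bracket x y $ V0 = x $ U2 * y $ V0 / 2 - sqrt 3 * x $ B * y $ V0 / 2 - x $ V0 * y $ U2 / 2 + sqrt 3 * x $ V0 * y $ B / 2"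
  "lalg_bracket x y $ V1 = x $ U2 * y $ V1 / 2 + x $ A * y $ V0 - sqrt 3 * x $ B * y $ V1 / 6 - x $ V0 * y $ A - x $ V1 * y $ U2 / 2 +
    sqrt 3 * x $ V1 * y $ B / 6"
  "lalg_bracket x y $ U0 = x $ U2 * y $ U0 / 2 - x $ A * y $ U1 + sqrt 3 * x $ B * y $ U0 / 2 - x $ U0 * y $ U2 / 2 -
    sqrt 3 * x $ U0 * y $ B / 2 + x $ U1 * y $ A"
  "lalg_bracket x y $ U1 = x $ U2 * y $ U1 / 2 - 2 * sqrt 3 * x $ A * y $ V1 / 3 + sqrt 3 * x $ B * y $ U1 / 6 +
    2 * sqrt 3 * x $ V1 * y $ A / 3 - x $ U1 * y $ U2 / 2 - sqrt 3 * x $ U1 * y $ B / 6"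
  by (simp_all add: lalg_bracket_def sum_gen axis_def inverse_sqrt_3 algebra_simps)

text \<open>The product determined by the Koszul formula for left-invariant fields,
  \<open>2 \<langle>\<nabla>\<^sub>x y, z\<rangle> = \<langle>[x, y], z\<rangle> - \<langle>[y, z], x\<rangle> + \<langle>[z, x], y\<rangle>\<close>, with
  \<open>\<epsilon>\<close> replaced by \<open>- \<epsilon>1 \<epsilon>2\<close>.\<close>

definition lalg_nabla :: "real \<Rightarrow> real \<Rightarrow> lalg \<Rightarrow> lalg \<Rightarrow> lalg" where
  "lalg_nabla \<epsilon>1 \<epsilon>2 x y = (\<chi> k. case k of
       V2 \<Rightarrow> - x $ V2 * y $ U2 - x $ V0 * y $ U0 / 2 - x $ V1 * y $ U1 / 2 + x $ U0 * y $ V0 / 2 + x $ U1 * y $ V1 / 2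
     | U2 \<Rightarrow> - \<epsilon>1 * x $ V2 * y $ V2 + \<epsilon>1 * \<epsilon>2 * x $ V0 * y $ V0 / 2 - \<epsilon>2 * x $ V1 * y $ V1 / 2 -
          \<epsilon>2 * x $ U0 * y $ U0 / 2 + \<epsilon>1 * \<epsilon>2 * x $ U1 * y $ U1 / 2
     | A \<Rightarrow> - sqrt 3 * x $ A * y $ B / 3 + \<epsilon>1 * \<epsilon>2 * x $ V0 * y $ V1 / 2 + \<epsilon>1 * \<epsilon>2 * x $ V1 * y $ V0 / 2 +
          sqrt 3 * \<epsilon>2 * x $ V1 * y $ U1 / 3 - \<epsilon>1 * \<epsilon>2 * x $ U0 * y $ U1 / 2 +
          sqrt 3 * \<epsilon>2 * x $ U1 * y $ V1 / 3 - \<epsilon>1 * \<epsilon>2 * x $ U1 * y $ U0 / 2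
     | B \<Rightarrow> - sqrt 3 * \<epsilon>1 * x $ A * y $ A / 3 - sqrt 3 * \<epsilon>1 * \<epsilon>2 * x $ V0 * y $ V0 / 2 +
          sqrt 3 * \<epsilon>2 * x $ V1 * y $ V1 / 6 - sqrt 3 * \<epsilon>2 * x $ U0 * y $ U0 / 2 +
          sqrt 3 * \<epsilon>1 * \<epsilon>2 * x $ U1 * y $ U1 / 6
     | V0 \<Rightarrow> \<epsilon>2 * x $ V2 * y $ U0 / 2 + \<epsilon>1 * x $ A * y $ V1 / 2 - x $ V0 * y $ U2 / 2 + sqrt 3 * x $ V0 * y $ B / 2 +
          \<epsilon>1 * x $ V1 * y $ A / 2 + \<epsilon>2 * x $ U0 * y $ V2 / 2
     | V1 \<Rightarrow> - \<epsilon>1 * \<epsilon>2 * x $ V2 * y $ U1 / 2 + x $ A * y $ V0 / 2 - sqrt 3 * \<epsilon>1 * x $ A * y $ U1 / 3 -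
          x $ V0 * y $ A / 2 - x $ V1 * y $ U2 / 2 + sqrt 3 * x $ V1 * y $ B / 6 - \<epsilon>1 * \<epsilon>2 * x $ U1 * y $ V2 / 2 -
          sqrt 3 * \<epsilon>1 * x $ U1 * y $ A / 3
     | U0 \<Rightarrow> \<epsilon>1 * \<epsilon>2 * x $ V2 * y $ V0 / 2 - x $ A * y $ U1 / 2 + \<epsilon>1 * \<epsilon>2 * x $ V0 * y $ V2 / 2 -
          x $ U0 * y $ U2 / 2 - sqrt 3 * x $ U0 * y $ B / 2 + x $ U1 * y $ A / 2
     | U1 \<Rightarrow> - \<epsilon>2 * x $ V2 * y $ V1 / 2 - sqrt 3 * x $ A * y $ V1 / 3 - \<epsilon>1 * x $ A * y $ U0 / 2 -
          \<epsilon>2 * x $ V1 * y $ V2 / 2 + sqrt 3 * x $ V1 * y $ A / 3 - \<epsilon>1 * x $ U0 * y $ A / 2 - x $ U1 * y $ U2 / 2 -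
          sqrt 3 * x $ U1 * y $ B / 6)"

lemma lalg_nabla_nth:
  "lalg_nabla \<epsilon>1 \<epsilon>2 x y $ V2 = - x $ V2 * y $ U2 - x $ V0 * y $ U0 / 2 - x $ V1 * y $ U1 / 2 + x $ U0 * y $ V0 / 2 + x $ U1 * y $ V1 / 2"
  "lalg_nabla \<epsilon>1 \<epsilon>2 x y $ U2 = - \<epsilon>1 * x $ V2 * y $ V2 + \<epsilon>1 * \<epsilon>2 * x $ V0 * y $ V0 / 2 - \<epsilon>2 * x $ V1 * y $ V1 / 2 -
    \<epsilon>2 * x $ U0 * y $ U0 / 2 + \<epsilon>1 * \<epsilon>2 * x $ U1 * y $ U1 / 2"
  "lalg_nabla \<epsilon>1 \<epsilon>2 x y $ A = - sqrt 3 * x $ A * y $ B / 3 + \<epsilon>1 * \<epsilon>2 * x $ V0 * y $ V1 / 2 + \<epsilon>1 * \<epsilon>2 * x $ V1 * y $ V0 / 2 +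
    sqrt 3 * \<epsilon>2 * x $ V1 * y $ U1 / 3 - \<epsilon>1 * \<epsilon>2 * x $ U0 * y $ U1 / 2 +
    sqrt 3 * \<epsilon>2 * x $ U1 * y $ V1 / 3 - \<epsilon>1 * \<epsilon>2 * x $ U1 * y $ U0 / 2"
  "lalg_nabla \<epsilon>1 \<epsilon>2 x y $ B = - sqrt 3 * \<epsilon>1 * x $ A * y $ A / 3 - sqrt 3 * \<epsilon>1 * \<epsilon>2 * x $ V0 * y $ V0 / 2 +
    sqrt 3 * \<epsilon>2 * x $ V1 * y $ V1 / 6 - sqrt 3 * \<epsilon>2 * x $ U0 * y $ U0 / 2 +
    sqrt 3 * \<epsilon>1 * \<epsilon>2 * x $ U1 * y $ U1 / 6"
  "lalg_nabla \<epsilon>1 \<epsilon>2 x y $ V0 = \<epsilon>2 * x $ V2 * y $ U0 / 2 + \<epsilon>1 * x $ A * y $ V1 / 2 - x $ V0 * y $ U2 / 2 + sqrt 3 * x $ V0 * y $ B / 2 +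
    \<epsilon>1 * x $ V1 * y $ A / 2 + \<epsilon>2 * x $ U0 * y $ V2 / 2"
  "lalg_nabla \<epsilon>1 \<epsilon>2 x y $ V1 = - \<epsilon>1 * \<epsilon>2 * x $ V2 * y $ U1 / 2 + x $ A * y $ V0 / 2 - sqrt 3 * \<epsilon>1 * x $ A * y $ U1 / 3 -
    x $ V0 * y $ A / 2 - x $ V1 * y $ U2 / 2 + sqrt 3 * x $ V1 * y $ B / 6 - \<epsilon>1 * \<epsilon>2 * x $ U1 * y $ V2 / 2 -
    sqrt 3 * \<epsilon>1 * x $ U1 * y $ A / 3"
  "lalg_nabla \<epsilon>1 \<epsilon>2 x y $ U0 = \<epsilon>1 * \<epsilon>2 * x $ V2 * y $ V0 / 2 - x $ A * y $ U1 / 2 + \<epsilon>1 * \<epsilon>2 * x $ V0 * y $ V2 / 2 -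
    x $ U0 * y $ U2 / 2 - sqrt 3 * x $ U0 * y $ B / 2 + x $ U1 * y $ A / 2"
  "lalg_nabla \<epsilon>1 \<epsilon>2 x y $ U1 = - \<epsilon>2 * x $ V2 * y $ V1 / 2 - sqrt 3 * x $ A * y $ V1 / 3 - \<epsilon>1 * x $ A * y $ U0 / 2 -
    \<epsilon>2 * x $ V1 * y $ V2 / 2 + sqrt 3 * x $ V1 * y $ A / 3 - \<epsilon>1 * x $ U0 * y $ A / 2 - x $ U1 * y $ U2 / 2 -
    sqrt 3 * x $ U1 * y $ B / 6"
  by (simp_all add: lalg_nabla_def)

text \<open>Every term with a factor \<epsilon>1 or \<epsilon>2 is symmetric in \<open>x\<close> and
  \<open>y\<close> and cancels; the remaining terms give the bracket.\<close>

lemma lalg_nabla_torsion_free: "lalg_nabla \<epsilon>1 \<epsilon>2 x y - lalg_nabla \<epsilon>1 \<epsilon>2 y x = lalg_bracket x y"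
  by (rule lalg_eqI) (simp_all add: lalg_nabla_nth lalg_bracket_nth field_simps)

lemma lalg_nabla_metric:
  assumes "\<epsilon>1 * \<epsilon>1 = 1" "\<epsilon>2 * \<epsilon>2 = 1"
  shows "lalg_scalar_product (- \<epsilon>1 * \<epsilon>2) \<epsilon>1 \<epsilon>2 (lalg_nabla \<epsilon>1 \<epsilon>2 x y) z +
    lalg_scalar_product (- \<epsilon>1 * \<epsilon>2) \<epsilon>1 \<epsilon>2 y (lalg_nabla \<epsilon>1 \<epsilon>2 x z) = 0"
proof -
  \<comment> \<open>Replacing the signs by numerals leaves four polynomial identities in the
    coordinates.\<close>
  have "\<epsilon>1 \<in> {-1, 1}" "\<epsilon>2 \<in> {-1, 1}"
    using assms by (auto simp: square_eq_1_iff)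
  then show ?thesis
    by (elim insertE emptyE)
      (simp_all add: lalg_scalar_product_def sum_gen lalg_nabla_nth field_simps)
qed

section \<open>Curvature of the product\<close>

definition lalg_curvature :: "real \<Rightarrow> real \<Rightarrow> lalg \<Rightarrow> lalg \<Rightarrow> lalg \<Rightarrow> lalg" where
  "lalg_curvature \<epsilon>1 \<epsilon>2 x y z =
     lalg_nabla \<epsilon>1 \<epsilon>2 x (lalg_nabla \<epsilon>1 \<epsilon>2 y z) - lalg_nabla \<epsilon>1 \<epsilon>2 y (lalg_nabla \<epsilon>1 \<epsilon>2 x z)
     - lalg_nabla \<epsilon>1 \<epsilon>2 (lalg_bracket x y) z"

text \<open>There is one identity for each of the 28 pairs of distinct generators. Inserting basis
  vectors makes both sides linear in the remaining argument, so each can be checked by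
  coordinates.\<close>

lemma lalg_curvature_basis:
  assumes "(\<epsilon>1, \<epsilon>2) \<in> {(-1, -1), (-1, 1), (1, -1)}" and "\<epsilon> = - \<epsilon>1 * \<epsilon>2"
  defines "N \<equiv> \<lambda>i. lalg_nabla \<epsilon>1 \<epsilon>2 (basis_vec i)"
    and "R \<equiv> \<lambda>i j. lalg_curvature \<epsilon>1 \<epsilon>2 (basis_vec i) (basis_vec j)"
  shows "
       R U2 V2 = - N V2 \<and> R U2 B = 0 \<and> R U2 A = 0 \<and>
       R U2 V0 = - (1 / 2) *\<^sub>R N V0 \<and> R U2 V1 = - (1 / 2) *\<^sub>R N V1 \<and>
       R U2 U0 = - (1 / 2) *\<^sub>R N U0 \<and> R U2 U1 = - (1 / 2) *\<^sub>R N U1 \<and>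
       R V2 B = 0 \<and> R V2 A = 0 \<and>
       R V2 V0 = (1 / 2 * \<epsilon>) *\<^sub>R N U0 \<and> R V2 V1 = (1 / 2 * \<epsilon>2) *\<^sub>R N U1 \<and>
       R V2 U0 = - (1 / 2 * \<epsilon>2) *\<^sub>R N V0 \<and> R V2 U1 = - (1 / 2 * \<epsilon>) *\<^sub>R N V1 \<and>
       R B A = - (1 / sqrt 3) *\<^sub>R N A \<and>
       R B V0 = (sqrt 3 / 2) *\<^sub>R N V0 \<and> R B V1 = (1 / (2 * sqrt 3)) *\<^sub>R N V1 \<and>
       R B U0 = - (sqrt 3 / 2) *\<^sub>R N U0 \<and> R B U1 = - (1 / (2 * sqrt 3)) *\<^sub>R N U1 \<and>
       R A V0 = - (1 / 2) *\<^sub>R N V1 \<and>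
       R A V1 = (1 / 2 * \<epsilon>1) *\<^sub>R N V0 + (1 / sqrt 3) *\<^sub>R N U1 \<and>
       R A U0 = - (1 / 2 * \<epsilon>1) *\<^sub>R N U1 \<and>
       R A U1 = (1 / 2) *\<^sub>R N U0 - (1 / sqrt 3 * \<epsilon>1) *\<^sub>R N V1 \<and>
       R V0 V1 = - (1 / 2 * \<epsilon>) *\<^sub>R N A \<and>
       R V0 U0 = (1 / 2) *\<^sub>R N V2 \<and> R V0 U1 = 0 \<and>
       R V1 U0 = 0 \<and>
       R V1 U1 = (1 / 2) *\<^sub>R N V2 + (1 / sqrt 3 * \<epsilon>2) *\<^sub>R N A \<and>
       R U0 U1 = - (1 / 2 * \<epsilon>) *\<^sub>R N A"
proof -
  from assms(1) consider "\<epsilon>1 = -1" "\<epsilon>2 = -1" | "\<epsilon>1 = -1" "\<epsilon>2 = 1" | "\<epsilon>1 = 1" "\<epsilon>2 = -1"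
    by auto
  then show ?thesis
    unfolding assms(2) N_def R_def
    \<comment> \<open>For each choice of signs, the endomorphisms are applied to an arbitrary vector
      and compared in eight coordinates; expanding product and bracket leaves linear identities over
      Q(sqrt 3).\<close>
    by cases
      ((simp only:; intro conjI ext lalg_eqI;
        simp add: lalg_curvature_def lalg_nabla_nth lalg_bracket_nth axis_def scaleR_fun_def
          inverse_sqrt_3; simp add: field_simps)+)
qed

section \<open>Transfer to the Lie group\<close>

theorem proposition13:
  fixes G :: "('a::{t2_space, second_countable_topology}, 'm) monoid_scheme"
    and \<A> :: "('a, 'e::euclidean_space) chart set"
    and \<Phi> :: "lalg \<Rightarrow> 'a vfield"
    and g :: "'a metric"
    and D :: "'a vfield \<Rightarrow> 'a vfield \<Rightarrow> 'a vfield"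
    and \<epsilon> \<epsilon>1 \<epsilon>2 :: real
  assumes "(\<epsilon>1, \<epsilon>2) \<in> {(-1, -1), (-1, 1), (1, -1)}"
    and "\<epsilon> = - \<epsilon>1 * \<epsilon>2"
    and "lie_group G \<A>"
    and "simply_connected (UNIV :: 'a set)"
    and "lie_algebra_identification G \<A> lalg_bracket \<Phi>"
    and "left_invariant_metric G \<A> g"
    and "\<And>x y. g \<one>\<^bsub>G\<^esub> (\<Phi> x \<one>\<^bsub>G\<^esub>) (\<Phi> y \<one>\<^bsub>G\<^esub>) = lalg_scalar_product \<epsilon> \<epsilon>1 \<epsilon>2 x y"
    and "levi_civita_connection \<A> g D"
  shows
    "let N = (\<lambda>i. nabla_op D \<Phi> (basis_vec i));
         R = (\<lambda>i j. curvature_op D \<Phi> (basis_vec i) (basis_vec j))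
     in
       R U2 V2 = - N V2 \<and> R U2 B = 0 \<and> R U2 A = 0 \<and>
       R U2 V0 = - (1 / 2) *\<^sub>R N V0 \<and> R U2 V1 = - (1 / 2) *\<^sub>R N V1 \<and>
       R U2 U0 = - (1 / 2) *\<^sub>R N U0 \<and> R U2 U1 = - (1 / 2) *\<^sub>R N U1 \<and>
       R V2 B = 0 \<and> R V2 A = 0 \<and>
       R V2 V0 = (1 / 2 * \<epsilon>) *\<^sub>R N U0 \<and> R V2 V1 = (1 / 2 * \<epsilon>2) *\<^sub>R N U1 \<and>
       R V2 U0 = - (1 / 2 * \<epsilon>2) *\<^sub>R N V0 \<and> R V2 U1 = - (1 / 2 * \<epsilon>) *\<^sub>R N V1 \<and>
       R B A = - (1 / sqrt 3) *\<^sub>R N A \<and>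
       R B V0 = (sqrt 3 / 2) *\<^sub>R N V0 \<and> R B V1 = (1 / (2 * sqrt 3)) *\<^sub>R N V1 \<and>
       R B U0 = - (sqrt 3 / 2) *\<^sub>R N U0 \<and> R B U1 = - (1 / (2 * sqrt 3)) *\<^sub>R N U1 \<and>
       R A V0 = - (1 / 2) *\<^sub>R N V1 \<and>
       R A V1 = (1 / 2 * \<epsilon>1) *\<^sub>R N V0 + (1 / sqrt 3) *\<^sub>R N U1 \<and>
       R A U0 = - (1 / 2 * \<epsilon>1) *\<^sub>R N U1 \<and>
       R A U1 = (1 / 2) *\<^sub>R N U0 - (1 / sqrt 3 * \<epsilon>1) *\<^sub>R N V1 \<and>
       R V0 V1 = - (1 / 2 * \<epsilon>) *\<^sub>R N A \<and>
       R V0 U0 = (1 / 2) *\<^sub>R N V2 \<and> R V0 U1 = 0 \<and>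
       R V1 U0 = 0 \<and>
       R V1 U1 = (1 / 2) *\<^sub>R N V2 + (1 / sqrt 3 * \<epsilon>2) *\<^sub>R N A \<and>
       R U0 U1 = - (1 / 2 * \<epsilon>) *\<^sub>R N A"
proof -
  have linear: "linear \<Phi>"
    using assms(5) by (simp add: lie_algebra_identification_def)
  have "\<epsilon>1 * \<epsilon>1 = 1" and "\<epsilon>2 * \<epsilon>2 = 1"
    using assms(1) by auto
  then have metric: "lalg_scalar_product \<epsilon> \<epsilon>1 \<epsilon>2 (lalg_nabla \<epsilon>1 \<epsilon>2 x y) z +
      lalg_scalar_product \<epsilon> \<epsilon>1 \<epsilon>2 y (lalg_nabla \<epsilon>1 \<epsilon>2 x z) = 0" for x y z
    by (simp only: assms(2) lalg_nabla_metric)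
  have D: "D (\<Phi> x) (\<Phi> y) = \<Phi> (lalg_nabla \<epsilon>1 \<epsilon>2 x y)" for x y
    using assms(3,5,6,7,8) lalg_nabla_torsion_free metric by (rule levi_civita_left_invariant)
  have N: "nabla_op D \<Phi> x = \<Phi> \<circ> lalg_nabla \<epsilon>1 \<epsilon>2 x" for x
    by (simp add: nabla_op_def D fun_eq_iff)
  have "vf_bracket (\<Phi> x) (\<Phi> y) = \<Phi> (lalg_bracket x y)" for x y
    using assms(5) by (simp add: lie_algebra_identification_def)
  \<comment> \<open>Covariant derivatives and brackets of left-invariant fields stay in the image of
    \<open>\<Phi>\<close>, so all three curvature terms are computed by the algebraic product and
    collected by linearity.\<close>
  then have R: "curvature_op D \<Phi> x y = \<Phi> \<circ> lalg_curvature \<epsilon>1 \<epsilon>2 x y" for x y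
    by (simp add: curvature_op_def curvature_def lalg_curvature_def D linear_diff[OF linear] comp_def)
  \<comment> \<open>Composition with the linear map \<open>\<Phi>\<close> respects the pointwise
    vector space structure and so carries identities between endomorphisms to identities between
    field-valued maps.\<close>
  have comp: "\<Phi> \<circ> (f + h) = (\<Phi> \<circ> f) + (\<Phi> \<circ> h)" "\<Phi> \<circ> (f - h) = (\<Phi> \<circ> f) - (\<Phi> \<circ> h)"
      "\<Phi> \<circ> (- f) = - (\<Phi> \<circ> f)" "\<Phi> \<circ> (c *\<^sub>R f) = c *\<^sub>R (\<Phi> \<circ> f)" "\<Phi> \<circ> 0 = 0"
    for f h :: "lalg \<Rightarrow> lalg" and c
    by (rule ext, simp add: linear_add[OF linear] linear_diff[OF linear] linear_neg[OF linear]
        linear_scale[OF linear] linear_0[OF linear] scaleR_fun_def[of c f]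
        scaleR_fun_def[of c "\<Phi> \<circ> f"])+
  show ?thesis
    unfolding Let_def N R
    using lalg_curvature_basis[OF assms(1,2)] by (simp only: comp)
qed

end
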